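(* Let $b_n=3n(n+1)+1$ for $n\ge 0$ and $a_n=-(2n-1)n^3$ for $n\ge 1$. Then the generalized continued fraction $$b_0+\cfrac{a_1}{b_{1}+\cfrac{a_{2}}{b_2 + \ddots}}$$ converges and equals $\dfrac{8}{\pi^2}$.
   Context: The value of the generalized continued fraction $b_0+\cfrac{a_1}{b_1+\cfrac{a_2}{b_2+\ddots}}$ is $\lim_{n\to\infty}A_n/B_n$, where $A_n=b_nA_{n-1}+a_nA_{n-2}$ and $B_n=b_nB_{n-1}+a_nB_{n-2}$ for $n\ge1$, with $A_{-1}=1$, $A_0=b_0$, $B_{-1}=0$, $B_0=1$. *)

theory Defs
  imports "HOL-Analysis.Analysis"
begin

text \<open>
  Numerators \<open>A\<^sub>n\<close> and denominators \<open>B\<^sub>n\<close> of the generalized continued fraction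
  \<open>b\<^sub>0 + a\<^sub>1 / (b\<^sub>1 + a\<^sub>2 / (b\<^sub>2 + \<dots>))\<close>.  The equations for index 1 are the general
  recurrence with the initial values \<open>A\<^sub>-\<^sub>1 = 1\<close> and \<open>B\<^sub>-\<^sub>1 = 0\<close> inserted.
  The value \<open>a 0\<close> is never used.
\<close>

fun gcf_num :: "(nat \<Rightarrow> real) \<Rightarrow> (nat \<Rightarrow> real) \<Rightarrow> nat \<Rightarrow> real" where
  "gcf_num a b 0 = b 0"
| "gcf_num a b (Suc 0) = b 1 * b 0 + a 1 * 1"
| "gcf_num a b (Suc (Suc n)) =
     b (Suc (Suc n)) * gcf_num a b (Suc n) + a (Suc (Suc n)) * gcf_num a b n"

fun gcf_den :: "(nat \<Rightarrow> real) \<Rightarrow> (nat \<Rightarrow> real) \<Rightarrow> nat \<Rightarrow> real" where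
  "gcf_den a b 0 = 1"
| "gcf_den a b (Suc 0) = b 1 * 1 + a 1 * 0"
| "gcf_den a b (Suc (Suc n)) =
     b (Suc (Suc n)) * gcf_den a b (Suc n) + a (Suc (Suc n)) * gcf_den a b n"

text \<open>
  Since \<open>x / 0 = 0\<close> in HOL, convergence explicitly demands that the convergents
  \<open>A\<^sub>n / B\<^sub>n\<close> are defined from some index on.
\<close>

definition gcf_converges_to :: "(nat \<Rightarrow> real) \<Rightarrow> (nat \<Rightarrow> real) \<Rightarrow> real \<Rightarrow> bool" where
  "gcf_converges_to a b L \<longleftrightarrow>
     (\<forall>\<^sub>F n in sequentially. gcf_den a b n \<noteq> 0) \<and>
     (\<lambda>n. gcf_num a b n / gcf_den a b n) \<longlonglongrightarrow> L"

end

theory Submission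
  imports Defs
begin

text \<open>
  The numerators are \<open>A\<^sub>n = (2n+2)! / 2\<^sup>n\<^sup>+\<^sup>1\<close>, and by the Wronskian (determinant) formula
  \<open>B\<^sub>n / A\<^sub>n\<close> is the partial sum up to \<open>m = n + 1\<close> of \<open>\<Sum>m\<ge>1. 2\<^sup>m (m!)\<^sup>2 / (m\<^sup>2 (2m)!)\<close>.
  This is the series \<open>\<Sum>m\<ge>1. 4\<^sup>m (m!)\<^sup>2 / (m\<^sup>2 (2m)!) x\<^sup>2\<^sup>m = 2 arcsin\<^sup>2 x\<close> at \<open>x = sin (\<pi>/4)\<close>,
  so \<open>B\<^sub>n / A\<^sub>n\<close> tends to \<open>\<pi>\<^sup>2/8\<close>.  The arcsine series follows from the first-order differential
  equation satisfied by the derivative of the power series in \<open>x\<^sup>2\<close>, which after the substitution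
  \<open>x = sin \<theta>\<close> says that \<open>\<Sum>m\<ge>1. 4\<^sup>m (m!)\<^sup>2 / (m\<^sup>2 (2m)!) sin\<^sup>2\<^sup>m \<theta>\<close> has second derivative 4.
\<close>

section \<open>The power series of the squared arcsine\<close>

text \<open>Division by zero makes the coefficient with index 0 vanish.\<close>

definition arcsin_sq_coeff :: "nat \<Rightarrow> real" where
  "arcsin_sq_coeff m = 4 ^ m * (fact m)\<^sup>2 / ((real m)\<^sup>2 * fact (2 * m))"

lemma arcsin_sq_coeff_0 [simp]: "arcsin_sq_coeff 0 = 0"
  by (simp add: arcsin_sq_coeff_def)

lemma arcsin_sq_coeff_1 [simp]: "arcsin_sq_coeff (Suc 0) = 2"
  by (simp add: arcsin_sq_coeff_def)

lemma arcsin_sq_coeff_pos: "m > 0 \<Longrightarrow> arcsin_sq_coeff m > 0"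
  by (simp add: arcsin_sq_coeff_def)

text \<open>The factorials cancel in the ratio of consecutive coefficients. At \<open>m = 0\<close>
  the identity would read \<open>2 = 0\<close>, because the coefficient at index 0 is a default
  value.\<close>

lemma arcsin_sq_coeff_Suc:
  assumes "m > 0"
  shows "(real m + 1) * (2 * real m + 1) * arcsin_sq_coeff (Suc m) =
           2 * (real m)\<^sup>2 * arcsin_sq_coeff m"
proof -
  define x where "x = real m"
  define f where "f = (fact (2 * m) :: real)"
  have pos: "x > 0" "f > 0"
    using assms by (auto simp: x_def f_def)
  have "arcsin_sq_coeff (Suc m) =
      4 * 4 ^ m * ((x + 1) * fact m)\<^sup>2 / ((x + 1)\<^sup>2 * ((2 * x + 2) * ((2 * x + 1) * f)))"
    by (simp add: arcsin_sq_coeff_def x_def f_def algebra_simps)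
  also have "\<dots> = 2 * (4 ^ m * (fact m)\<^sup>2 / f) / ((x + 1) * (2 * x + 1))"
    using pos by (simp add: divide_simps)
  also have "4 ^ m * (fact m)\<^sup>2 / f = x\<^sup>2 * arcsin_sq_coeff m"
    using pos by (simp add: arcsin_sq_coeff_def x_def f_def)
  finally show ?thesis
    using pos unfolding x_def [symmetric] by simp
qed

text \<open>From index 1, where the value is 2, the coefficients do not increase, since their ratio
  is at most 1. This crude bound suffices for comparison with a geometric series.\<close>

lemma arcsin_sq_coeff_le: "arcsin_sq_coeff m \<le> 2"
proof (induction m)
  case (Suc m)
  show ?case
  proof (cases "m = 0")
    case False
    have "2 * (real m)\<^sup>2 \<le> (real m + 1) * (2 * real m + 1)"
      by (simp add: power2_eq_square algebra_simps)
    then have "(real m + 1) * (2 * real m + 1) * arcsin_sq_coeff (Suc m) \<le>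
        (real m + 1) * (2 * real m + 1) * 2"
      unfolding arcsin_sq_coeff_Suc [OF False [THEN neq0_conv [THEN iffD1]]]
      using arcsin_sq_coeff_pos [of m] Suc False
      by (intro mult_mono [of "2 * (real m)\<^sup>2"]) auto
    then show ?thesis
      by (subst (asm) mult_le_cancel_left_pos) (auto intro!: mult_pos_pos add_nonneg_pos)
  qed simp
qed simp

lemma summable_arcsin_sq:
  fixes z :: real
  assumes "norm z < 1"
  shows "summable (\<lambda>n. arcsin_sq_coeff n * z ^ n)"
proof (rule summable_comparison_test)
  have "norm (arcsin_sq_coeff n) \<le> 2" for n
    using arcsin_sq_coeff_le [of n] arcsin_sq_coeff_pos [of n] by (cases "n = 0") auto
  then show "\<exists>N. \<forall>n\<ge>N. norm (arcsin_sq_coeff n * z ^ n) \<le> 2 * norm z ^ n"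
    unfolding norm_mult norm_power by (blast intro: mult_right_mono zero_le_power norm_ge_zero)
  show "summable (\<lambda>n. 2 * norm z ^ n)"
    using assms by (intro summable_mult summable_geometric) auto
qed

text \<open>Multiplying the recurrence \<open>(2 * n + 3) * p (Suc n) = 2 * (n + 1) * p n\<close> by
  \<open>s ^ Suc n\<close> and summing turns each factor \<open>n\<close> into the operator
  \<open>s * d/ds\<close>.\<close>

lemma arcsin_sq_ode:
  fixes s :: real
  defines "p \<equiv> diffs arcsin_sq_coeff"
  assumes s: "norm s < 1"
  shows "2 * s * (1 - s) * (\<Sum>n. diffs p n * s ^ n) + (1 - 2 * s) * (\<Sum>n. p n * s ^ n) = 2"
proof -
  have summable_p: "summable (\<lambda>n. p n * z ^ n)" if "norm z < 1" for z
    unfolding p_def using termdiff_converges [OF that summable_arcsin_sq] .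
  define Q where "Q = (\<Sum>n. p n * s ^ n)"
  define R where "R = (\<Sum>n. diffs p n * s ^ n)"
  have Q: "(\<lambda>n. p n * s ^ n) sums Q"
    unfolding Q_def using summable_p [OF s] by (rule summable_sums)
  have "(\<lambda>n. diffs p n * s ^ n) sums R"
    unfolding R_def using termdiff_converges [OF s summable_p] by (rule summable_sums)
  from sums_mult [OF this, of s]
  have "(\<lambda>n. real (Suc n) * p (Suc n) * s ^ Suc n) sums (s * R)"
    by (simp add: diffs_def mult_ac)
  then have R: "(\<lambda>n. real n * p n * s ^ n) sums (s * R)"
    by (subst (asm) sums_Suc_iff) simp
  have p0: "p 0 = 2"
    by (simp add: p_def diffs_def)
  have rec: "(2 * real n + 3) * p (Suc n) = 2 * (real n + 1) * p n" for n
    using arcsin_sq_coeff_Suc [of "Suc n"]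
    by (simp add: p_def diffs_def power2_eq_square algebra_simps)
  have "(\<lambda>n. (2 * real n + 1) * p n * s ^ n) sums (2 * (s * R) + Q)"
    using sums_add [OF sums_mult [OF R, of 2] Q] by (simp add: algebra_simps)
  \<comment> \<open>Dropping the term \<open>p 0 = 2\<close> at index 0 creates the inhomogeneity of
    the equation.\<close>
  then have "(\<lambda>n. (2 * real (Suc n) + 1) * p (Suc n) * s ^ Suc n) sums (2 * (s * R) + Q - 2)"
    by (subst sums_Suc_iff) (simp add: p0)
  also have "(\<lambda>n. (2 * real (Suc n) + 1) * p (Suc n) * s ^ Suc n) =
      (\<lambda>n. 2 * s * (real n * p n * s ^ n + p n * s ^ n))"
  proof
    fix n
    have "(2 * real (Suc n) + 1) * p (Suc n) = 2 * (real n + 1) * p n"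
      using rec [of n] by (simp add: algebra_simps)
    then show "(2 * real (Suc n) + 1) * p (Suc n) * s ^ Suc n =
        2 * s * (real n * p n * s ^ n + p n * s ^ n)"
      by (simp only:) (simp add: algebra_simps)
  qed
  finally have "2 * (s * R) + Q - 2 = 2 * s * (s * R + Q)"
    using sums_mult [OF sums_add [OF R Q], of "2 * s"] sums_unique2 by blast
  then show ?thesis
    unfolding Q_def [symmetric] R_def [symmetric] by (simp add: algebra_simps)
qed

lemma arcsin_sq_sums:
  fixes \<theta> :: real
  assumes \<theta>: "\<bar>\<theta>\<bar> < pi / 2"
  shows "(\<lambda>n. arcsin_sq_coeff n * ((sin \<theta>)\<^sup>2) ^ n) sums (2 * \<theta>\<^sup>2)"
proof -
  define I where "I = {- (pi / 2)<..<pi / 2}"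
  define p where "p = diffs arcsin_sq_coeff"
  define P where "P = (\<lambda>z::real. \<Sum>n. arcsin_sq_coeff n * z ^ n)"
  define Q where "Q = (\<lambda>z::real. \<Sum>n. p n * z ^ n)"
  define R where "R = (\<lambda>z::real. \<Sum>n. diffs p n * z ^ n)"
  have summable_p: "summable (\<lambda>n. p n * z ^ n)" if "norm z < 1" for z
    unfolding p_def using termdiff_converges [OF that summable_arcsin_sq] .
  have derP: "(P has_field_derivative Q z) (at z)" if "norm z < 1" for z
    unfolding P_def Q_def p_def by (rule termdiffs_strong' [OF summable_arcsin_sq that])
  have derQ: "(Q has_field_derivative R z) (at z)" if "norm z < 1" for z
    unfolding Q_def R_def by (rule termdiffs_strong' [OF summable_p that])
  have sin_less: "norm ((sin x)\<^sup>2) < 1" if "x \<in> I" for x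
  proof -
    have "cos x > 0"
      using that by (intro cos_gt_zero_pi) (auto simp: I_def)
    then have "(cos x)\<^sup>2 > 0"
      by simp
    then have "(sin x)\<^sup>2 < 1"
      using sin_cos_squared_add [of x] by linarith
    then show ?thesis
      by simp
  qed
  have I: "convex I" "0 \<in> I" "\<theta> \<in> I"
    using \<theta> by (auto simp: I_def)
  \<comment> \<open>By the chain rule the left side is half the derivative of
    \<open>P ((sin x)\<^sup>2)\<close>. The differential equation says that its own derivative is 2,
    and it vanishes at 0.\<close>
  have half: "sin x * cos x * Q ((sin x)\<^sup>2) = 2 * x" if x: "x \<in> I" for x
  proof -
    have "((\<lambda>x. sin x * cos x * Q ((sin x)\<^sup>2) - 2 * x) has_field_derivative 0) (at y within I)"
      if y: "y \<in> I" for y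
    proof -
      define s where "s = (sin y)\<^sup>2"
      have c: "(cos y)\<^sup>2 = 1 - s"
        unfolding s_def by (simp add: cos_squared_eq)
      have "2 * s * (1 - s) * R s + (1 - 2 * s) * Q s = 2"
        unfolding R_def Q_def p_def s_def by (rule arcsin_sq_ode [OF sin_less [OF y]])
      moreover have "(cos y * cos y - sin y * sin y) * Q s +
          sin y * cos y * (R s * (2 * sin y * cos y)) =
          (1 - 2 * s) * Q s + 2 * s * (1 - s) * R s"
        using c unfolding s_def by algebra
      ultimately have eq: "(cos y * cos y - sin y * sin y) * Q s +
          sin y * cos y * (R s * (2 * sin y * cos y)) - 2 = 0"
        by simp
      have "((\<lambda>x. (sin x)\<^sup>2) has_field_derivative 2 * sin y * cos y) (at y)"
        by (auto intro!: derivative_eq_intros)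
      from DERIV_chain2 [OF derQ this] sin_less [OF y]
      have "((\<lambda>x. Q ((sin x)\<^sup>2)) has_field_derivative R s * (2 * sin y * cos y)) (at y)"
        by (simp add: s_def)
      then have "((\<lambda>x. sin x * cos x * Q ((sin x)\<^sup>2) - 2 * x) has_field_derivative
          (cos y * cos y - sin y * sin y) * Q s + sin y * cos y * (R s * (2 * sin y * cos y)) - 2)
          (at y)"
        by (auto intro!: derivative_eq_intros simp: s_def algebra_simps)
      then show ?thesis
        unfolding eq by (rule has_field_derivative_at_within)
    qed
    from has_field_derivative_zero_constant [OF I(1) this] obtain k
      where k: "\<And>y. y \<in> I \<Longrightarrow> sin y * cos y * Q ((sin y)\<^sup>2) - 2 * y = k"
      by blast
    show ?thesis
      using k [OF I(2)] k [OF x] by simp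
  qed
  have "((\<lambda>x. P ((sin x)\<^sup>2) - 2 * x\<^sup>2) has_field_derivative 0) (at y within I)"
    if y: "y \<in> I" for y
  proof -
    have "((\<lambda>x. (sin x)\<^sup>2) has_field_derivative 2 * sin y * cos y) (at y)"
      by (auto intro!: derivative_eq_intros)
    from DERIV_chain2 [OF derP this] sin_less [OF y]
    have "((\<lambda>x. P ((sin x)\<^sup>2)) has_field_derivative Q ((sin y)\<^sup>2) * (2 * sin y * cos y)) (at y)"
      by simp
    also have "Q ((sin y)\<^sup>2) * (2 * sin y * cos y) = 4 * y"
      using half [OF y] by (simp add: algebra_simps)
    finally have "((\<lambda>x. P ((sin x)\<^sup>2) - 2 * x\<^sup>2) has_field_derivative 0) (at y)"
      by (auto intro!: derivative_eq_intros)
    then show ?thesis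
      by (rule has_field_derivative_at_within)
  qed
  from has_field_derivative_zero_constant [OF I(1) this] obtain k
    where k: "\<And>y. y \<in> I \<Longrightarrow> P ((sin y)\<^sup>2) - 2 * y\<^sup>2 = k"
    by blast
  have "P 0 = 0"
    unfolding P_def by simp
  then have "P ((sin \<theta>)\<^sup>2) = 2 * \<theta>\<^sup>2"
    using k [OF I(2)] k [OF I(3)] by simp
  then show ?thesis
    using summable_sums [OF summable_arcsin_sq [OF sin_less [OF I(3)]]] by (simp add: P_def)
qed

corollary arcsin_sq_sums_half: "(\<lambda>n. arcsin_sq_coeff n * (1 / 2) ^ n) sums (pi\<^sup>2 / 8)"
proof -
  have "(sin (pi / 4))\<^sup>2 = 1 / 2"
    by (simp add: sin_45 power_divide)
  moreover have "(\<lambda>n. arcsin_sq_coeff n * ((sin (pi / 4))\<^sup>2) ^ n) sums (2 * (pi / 4)\<^sup>2)"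
    by (rule arcsin_sq_sums) simp
  moreover have "2 * (pi / 4)\<^sup>2 = pi\<^sup>2 / 8"
    by (simp add: power2_eq_square)
  ultimately show ?thesis
    by (simp only:)
qed

section \<open>The convergents\<close>

context
  fixes a b :: "nat \<Rightarrow> real"
  assumes b: "\<And>n. b n = 3 * real n * (real n + 1) + 1"
    and a: "\<And>n. n \<ge> 1 \<Longrightarrow> a n = - (2 * real n - 1) * real n ^ 3"
begin

text \<open>The closed form satisfies the same recurrence: after division by the value at
  \<open>n + 1\<close>, this is \<open>3 * (x + 2) * (x + 3) + 1 - (x + 2)\<^sup>2 = (x + 3) * (2 *
  x + 5)\<close> with \<open>x = n\<close>.\<close>

lemma gcf_num_eq: "gcf_num a b n = fact (2 * n + 2) / 2 ^ (n + 1)"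
proof (induction n rule: induct_nat_012)
  case (ge2 n)
  define x where "x = real n"
  define g where "g = fact (2 * n + 2) / (2 ^ (n + 1) :: real)"
  have g1: "fact (2 * Suc n + 2) / 2 ^ (Suc n + 1) = (x + 2) * (2 * x + 3) * g"
    by (simp add: g_def x_def field_simps)
  have "fact (2 * Suc (Suc n) + 2) / 2 ^ (Suc (Suc n) + 1) =
      (x + 3) * (2 * x + 5) * (fact (2 * Suc n + 2) / 2 ^ (Suc n + 1))"
    by (simp add: x_def field_simps)
  then have g2: "fact (2 * Suc (Suc n) + 2) / 2 ^ (Suc (Suc n) + 1) =
      (x + 3) * (2 * x + 5) * ((x + 2) * (2 * x + 3) * g)"
    unfolding g1 .
  have "gcf_num a b (Suc (Suc n)) = (3 * (x + 2) * (x + 3) + 1) * ((x + 2) * (2 * x + 3) * g) -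
      (2 * x + 3) * (x + 2) ^ 3 * g"
    unfolding gcf_num.simps ge2 g1 g_def [symmetric] b
    by (subst a) (simp_all add: x_def algebra_simps)
  also have "\<dots> = (x + 3) * (2 * x + 5) * ((x + 2) * (2 * x + 3) * g)"
    by algebra
  finally show ?case
    unfolding g2 .
qed (simp_all add: b a fact_numeral)

text \<open>The numerators solve the recurrence too, so the common partial sum \<open>S\<close>
  factors out of the induction step. What remains must supply the one new summand.\<close>

lemma gcf_den_eq:
  "gcf_den a b n = gcf_num a b n * (\<Sum>m\<le>n + 1. arcsin_sq_coeff m * (1 / 2) ^ m)"
proof (induction n rule: induct_nat_012)
  case 1
  have "arcsin_sq_coeff 2 = 2 / 3"
    using arcsin_sq_coeff_Suc [of 1] by (simp add: numeral_2_eq_2)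
  then show ?case
    by (simp add: a b numeral_2_eq_2)
next
  case (ge2 n)
  define x where "x = real n"
  define S where "S = (\<Sum>m\<le>n + 1. arcsin_sq_coeff m * (1 / 2) ^ m)"
  define t where "t = (\<lambda>m. arcsin_sq_coeff m * (1 / 2) ^ m)"
  define A where "A = gcf_num a b"
  \<comment> \<open>The weight \<open>1 / 2\<close> absorbs the factor 2 of the coefficient
    recurrence.\<close>
  have t: "(x + 3) * (2 * x + 5) * t (n + 3) = (x + 2)\<^sup>2 * t (n + 2)"
    using arcsin_sq_coeff_Suc [of "n + 2"]
    by (simp add: t_def x_def eval_nat_numeral field_simps)
  have A2: "A (Suc (Suc n)) = (x + 3) * (2 * x + 5) * A (Suc n)"
    unfolding A_def gcf_num_eq by (simp add: x_def field_simps)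
  \<comment> \<open>The first part is the ratio of consecutive numerators and keeps the summand
    \<open>t (n + 2)\<close>; the square turns it into \<open>t (n + 3)\<close> by
    \<open>t\<close>.\<close>
  have bt: "b (Suc (Suc n)) = (x + 3) * (2 * x + 5) + (x + 2)\<^sup>2"
    by (simp add: b x_def power2_eq_square algebra_simps)
  have rec: "A (Suc (Suc n)) = b (Suc (Suc n)) * A (Suc n) + a (Suc (Suc n)) * A n"
    by (simp add: A_def)
  have "gcf_den a b (Suc (Suc n)) =
      b (Suc (Suc n)) * (A (Suc n) * (S + t (n + 2))) + a (Suc (Suc n)) * (A n * S)"
    unfolding gcf_den.simps ge2 by (simp add: A_def S_def t_def)
  also have "\<dots> = A (Suc (Suc n)) * S + b (Suc (Suc n)) * A (Suc n) * t (n + 2)"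
    unfolding rec by (simp add: algebra_simps)
  also have "b (Suc (Suc n)) * A (Suc n) * t (n + 2) =
      A (Suc (Suc n)) * t (n + 2) + A (Suc n) * ((x + 2)\<^sup>2 * t (n + 2))"
    unfolding bt A2 by (simp add: algebra_simps)
  also have "A (Suc n) * ((x + 2)\<^sup>2 * t (n + 2)) = A (Suc (Suc n)) * t (n + 3)"
    unfolding t [symmetric] A2 by simp
  finally show ?case
    by (simp add: A_def S_def t_def eval_nat_numeral algebra_simps)
qed (simp add: b)

end

theorem theorem1p5:
  fixes a b :: "nat \<Rightarrow> real"
  assumes "\<And>n. b n = 3 * real n * (real n + 1) + 1"
    and "\<And>n. n \<ge> 1 \<Longrightarrow> a n = - (2 * real n - 1) * real n ^ 3"
  shows "gcf_converges_to a b (8 / pi\<^sup>2)"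
proof -
  define S where "S = (\<lambda>n. \<Sum>m\<le>n + 1. arcsin_sq_coeff m * (1 / 2) ^ m)"
  have A: "gcf_num a b n > 0" for n
    by (simp add: gcf_num_eq [OF assms])
  have B: "gcf_den a b n = gcf_num a b n * S n" for n
    unfolding S_def by (rule gcf_den_eq [OF assms])
  \<comment> \<open>The sum always contains the positive term at index 1. Hence no denominator
    vanishes, and every convergent is defined.\<close>
  have S: "S n > 0" for n
    unfolding S_def
  proof (rule sum_pos2)
    show "0 < arcsin_sq_coeff 1 * (1 / 2) ^ 1"
      by simp
    show "0 \<le> arcsin_sq_coeff m * (1 / 2) ^ m" for m
      using arcsin_sq_coeff_pos [of m] by (cases "m = 0") auto
  qed auto
  have "(\<lambda>n. \<Sum>m\<le>n. arcsin_sq_coeff m * (1 / 2) ^ m) \<longlonglongrightarrow> pi\<^sup>2 / 8"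
    using arcsin_sq_sums_half by (simp add: sums_def_le)
  then have "S \<longlonglongrightarrow> pi\<^sup>2 / 8"
    unfolding S_def by (rule LIMSEQ_ignore_initial_segment)
  then have "(\<lambda>n. inverse (S n)) \<longlonglongrightarrow> inverse (pi\<^sup>2 / 8)"
    by (rule tendsto_inverse) simp
  moreover have "gcf_num a b n / gcf_den a b n = inverse (S n)" for n
    using A [of n] by (simp add: B field_simps)
  moreover have "gcf_den a b n \<noteq> 0" for n
    using A [of n] S [of n] by (simp add: B)
  ultimately show ?thesis
    by (simp add: gcf_converges_to_def)
qed

end
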